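(* Let $Q$ be a loop. Then $A(Q) = \langle a^{\cdot\cdot}(x,y,z),\ b^{\cdot\cdot}(x,y,z) : x,y,z\in Q\rangle$, where the right-hand side is the subloop of $Q$ generated by the indicated elements.
   Context: A loop is a set $Q$ with a binary operation (written multiplicatively) and identity element $1$ such that for all $a,b\in Q$ the equations $ax=b$ and $ya=b$ have unique solutions $x,y\in Q$. A subloop $N$ of $Q$ is normal if $xN=Nx$, $x(yN)=(xy)N$, $N(xy)=(Nx)y$ for all $x,y\in Q$. The associator subloop $A(Q)$ is the smallest normal subloop of $Q$ such that $Q/A(Q)$ is a group. The elements $a^{\cdot\cdot}(x,y,z)$ and $b^{\cdot\cdot}(x,y,z)$ are the unique elements of $Q$ satisfying $$(xy)z=(a^{\cdot\cdot}(x,y,z)\,x)(yz),\qquad z(yx)=(zy)(x\,b^{\cdot\cdot}(x,y,z)).$$ *)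

theory Defs
  imports "HOL-Algebra.Coset" "HOL.Hull"
begin

locale loop =
  fixes Q (structure)
  assumes m_closed [intro, simp]: "\<lbrakk>x \<in> carrier Q; y \<in> carrier Q\<rbrakk> \<Longrightarrow> x \<otimes> y \<in> carrier Q"
    and one_closed [intro, simp]: "\<one> \<in> carrier Q"
    and l_one [simp]: "x \<in> carrier Q \<Longrightarrow> \<one> \<otimes> x = x"
    and r_one [simp]: "x \<in> carrier Q \<Longrightarrow> x \<otimes> \<one> = x"
    and ex1_left_div: "\<lbrakk>a \<in> carrier Q; b \<in> carrier Q\<rbrakk> \<Longrightarrow> \<exists>!x\<in>carrier Q. a \<otimes> x = b"
    and ex1_right_div: "\<lbrakk>a \<in> carrier Q; b \<in> carrier Q\<rbrakk> \<Longrightarrow> \<exists>!y\<in>carrier Q. y \<otimes> a = b"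

text \<open>Requiring a subloop to share the identity of \<open>Q\<close> costs nothing: by cancellation, an
  idempotent element of a loop is its identity.\<close>

definition subloop :: "'a set \<Rightarrow> ('a, 'b) monoid_scheme \<Rightarrow> bool"
  where "subloop N Q \<longleftrightarrow> N \<subseteq> carrier Q \<and> loop (Q\<lparr>carrier := N\<rparr>)"

definition normal_subloop :: "'a set \<Rightarrow> ('a, 'b) monoid_scheme \<Rightarrow> bool"
  where "normal_subloop N Q \<longleftrightarrow> subloop N Q \<and>
    (\<forall>x\<in>carrier Q. \<forall>y\<in>carrier Q.
       x <#\<^bsub>Q\<^esub> N = N #>\<^bsub>Q\<^esub> x \<and>
       x <#\<^bsub>Q\<^esub> (y <#\<^bsub>Q\<^esub> N) = (x \<otimes>\<^bsub>Q\<^esub> y) <#\<^bsub>Q\<^esub> N \<and>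
       N #>\<^bsub>Q\<^esub> (x \<otimes>\<^bsub>Q\<^esub> y) = (N #>\<^bsub>Q\<^esub> x) #>\<^bsub>Q\<^esub> y)"

text \<open>The quotient of \<open>Q\<close> by a normal subloop \<open>N\<close> is \<^term>\<open>Q Mod N\<close>, whose underlying set
  consists of the cosets of \<open>N\<close> and whose product is the elementwise product of sets. For loops,
  too, this product is the usual one on cosets:\<close>

lemma (in loop) rcoset_mult:
  assumes "normal_subloop N Q" and x: "x \<in> carrier Q" and y: "y \<in> carrier Q"
  shows "(N #> x) <#> (N #> y) = N #> (x \<otimes> y)"
proof -
  have sub: "N \<subseteq> carrier Q" and loopN: "loop (Q\<lparr>carrier := N\<rparr>)"
    and comm: "\<And>u. u \<in> carrier Q \<Longrightarrow> u <# N = N #> u"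
    and lft: "\<And>u v. \<lbrakk>u \<in> carrier Q; v \<in> carrier Q\<rbrakk> \<Longrightarrow> u <# (v <# N) = (u \<otimes> v) <# N"
    and rgt: "\<And>u v. \<lbrakk>u \<in> carrier Q; v \<in> carrier Q\<rbrakk> \<Longrightarrow> N #> (u \<otimes> v) = (N #> u) #> v"
    using assms(1) unfolding normal_subloop_def subloop_def by blast+
  have absorb: "n <# N = N" if n: "n \<in> N" for n
  proof
    show "n <# N \<subseteq> N"
      using loop.m_closed[OF loopN] n by (auto simp: l_coset_def)
    show "N \<subseteq> n <# N"
    proof
      fix b assume "b \<in> N"
      then obtain k where "k \<in> N" "n \<otimes> k = b"
        using loop.ex1_left_div[OF loopN, of n b] n by auto
      then show "b \<in> n <# N" by (auto simp: l_coset_def)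
    qed
  qed
  have coset: "(n \<otimes> x) <# (N #> y) = N #> (x \<otimes> y)" if n: "n \<in> N" for n
  proof -
    have nQ: "n \<in> carrier Q" using n sub by blast
    have "(n \<otimes> x) \<otimes> y \<in> (N #> x) #> y"
      using n by (auto simp: r_coset_def)
    then have "(n \<otimes> x) \<otimes> y \<in> (x \<otimes> y) <# N"
      using rgt[OF x y] comm[of "x \<otimes> y"] x y by simp
    then obtain m where m: "m \<in> N" "(n \<otimes> x) \<otimes> y = (x \<otimes> y) \<otimes> m"
      by (auto simp: l_coset_def)
    then have mQ: "m \<in> carrier Q" using sub by blast
    have "(n \<otimes> x) <# (N #> y) = (n \<otimes> x) <# (y <# N)"
      using comm[OF y] by simp
    also have "\<dots> = ((x \<otimes> y) \<otimes> m) <# N"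
      using lft[of "n \<otimes> x" y] nQ x y m(2) by simp
    also have "\<dots> = (x \<otimes> y) <# (m <# N)"
      using lft[of "x \<otimes> y" m] mQ x y by simp
    also have "\<dots> = N #> (x \<otimes> y)"
      using absorb[OF m(1)] comm[of "x \<otimes> y"] x y by simp
    finally show ?thesis .
  qed
  have "(N #> x) <#> (N #> y) = (\<Union>n\<in>N. (n \<otimes> x) <# (N #> y))"
    by (auto simp: set_mult_def l_coset_def r_coset_def)
  also have "\<dots> = N #> (x \<otimes> y)"
    using coset loop.one_closed[OF loopN] by auto
  finally show ?thesis .
qed

definition associator_subloop :: "('a, 'b) monoid_scheme \<Rightarrow> 'a set"
  where "associator_subloop Q = (LEAST N. normal_subloop N Q \<and> group (Q Mod N))"

definition generated_subloop :: "('a, 'b) monoid_scheme \<Rightarrow> 'a set \<Rightarrow> 'a set"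
  where "generated_subloop Q S = (\<lambda>H. subloop H Q) hull S"

definition assoc_a :: "('a, 'b) monoid_scheme \<Rightarrow> 'a \<Rightarrow> 'a \<Rightarrow> 'a \<Rightarrow> 'a"
  where "assoc_a Q x y z = (THE a. a \<in> carrier Q \<and>
    (x \<otimes>\<^bsub>Q\<^esub> y) \<otimes>\<^bsub>Q\<^esub> z = (a \<otimes>\<^bsub>Q\<^esub> x) \<otimes>\<^bsub>Q\<^esub> (y \<otimes>\<^bsub>Q\<^esub> z))"

definition assoc_b :: "('a, 'b) monoid_scheme \<Rightarrow> 'a \<Rightarrow> 'a \<Rightarrow> 'a \<Rightarrow> 'a"
  where "assoc_b Q x y z = (THE b. b \<in> carrier Q \<and>
    z \<otimes>\<^bsub>Q\<^esub> (y \<otimes>\<^bsub>Q\<^esub> x) = (z \<otimes>\<^bsub>Q\<^esub> y) \<otimes>\<^bsub>Q\<^esub> (x \<otimes>\<^bsub>Q\<^esub> b))"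

end

theory Submission
  imports Defs
begin

text \<open>Let \<open>S\<close> be the subloop generated by the associators \<open>a(x,y,z)\<close> alone. The identity
  \<open>(s x) y = (a(s,x,y) s) (x y)\<close> gives \<open>(S x) y = S (x y)\<close>, so right multiplication permutes the
  right cosets of \<open>S\<close>; since moreover \<open>S ((x y) z) = S (x (y z))\<close>, this defines a homomorphism
  from \<open>Q\<close> to a permutation group. Its kernel is contained in the stabilizer of the coset \<open>S\<close>,
  which is \<open>S\<close> itself. Conversely the kernel is a subloop, and it contains every \<open>a(x,y,z)\<close>
  because its quotient is a group; hence it equals \<open>S\<close>. So \<open>S\<close> is normal with a group as
  quotient, and therefore contains the elements \<open>b(x,y,z)\<close> too.\<close>

context loop
begin

section \<open>Division, cancellation and generated subloops\<close>

lemma left_div: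
  assumes "a \<in> carrier Q" "b \<in> carrier Q"
  obtains x where "x \<in> carrier Q" "a \<otimes> x = b"
  using ex1_left_div[OF assms] by blast

lemma right_div:
  assumes "a \<in> carrier Q" "b \<in> carrier Q"
  obtains y where "y \<in> carrier Q" "y \<otimes> a = b"
  using ex1_right_div[OF assms] by blast

lemma left_cancel:
  "\<lbrakk>a \<otimes> x = a \<otimes> y; a \<in> carrier Q; x \<in> carrier Q; y \<in> carrier Q\<rbrakk> \<Longrightarrow> x = y"
  using ex1_left_div[of a "a \<otimes> x"] by (metis m_closed)

lemma right_cancel:
  "\<lbrakk>x \<otimes> a = y \<otimes> a; a \<in> carrier Q; x \<in> carrier Q; y \<in> carrier Q\<rbrakk> \<Longrightarrow> x = y"
  using ex1_right_div[of a "x \<otimes> a"] by (metis m_closed)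

text \<open>By cancellation, a quotient computed in \<open>N\<close> is the one computed in
  \<open>Q\<close>, so being a loop amounts to closure under the product and both divisions. In this
  form the condition passes to intersections and can be checked element by element.\<close>

lemma subloop_iff:
  "subloop N Q \<longleftrightarrow> N \<subseteq> carrier Q \<and> \<one> \<in> N \<and> (\<forall>x\<in>N. \<forall>y\<in>N. x \<otimes> y \<in> N) \<and>
    (\<forall>x\<in>carrier Q. \<forall>a\<in>N. a \<otimes> x \<in> N \<longrightarrow> x \<in> N) \<and>
    (\<forall>y\<in>carrier Q. \<forall>a\<in>N. y \<otimes> a \<in> N \<longrightarrow> y \<in> N)"
  (is "_ \<longleftrightarrow> ?R")
proof
  assume sub: "subloop N Q"
  then have NQ: "N \<subseteq> carrier Q" and loopN: "loop (Q\<lparr>carrier := N\<rparr>)"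
    unfolding subloop_def by auto
  have "x \<in> N" if h: "x \<in> carrier Q" "a \<in> N" "a \<otimes> x \<in> N" for x a
  proof -
    obtain x' where "x' \<in> N" "a \<otimes> x' = a \<otimes> x"
      using loop.ex1_left_div[OF loopN, of a "a \<otimes> x"] h by auto
    then show ?thesis
      using left_cancel[of a x' x] h NQ by auto
  qed
  moreover have "y \<in> N" if h: "y \<in> carrier Q" "a \<in> N" "y \<otimes> a \<in> N" for y a
  proof -
    obtain y' where "y' \<in> N" "y' \<otimes> a = y \<otimes> a"
      using loop.ex1_right_div[OF loopN, of a "y \<otimes> a"] h by auto
    then show ?thesis
      using right_cancel[of y' a y] h NQ by auto
  qed
  moreover have "\<one> \<in> N" "\<And>x y. \<lbrakk>x \<in> N; y \<in> N\<rbrakk> \<Longrightarrow> x \<otimes> y \<in> N"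
    using loop.one_closed[OF loopN] loop.m_closed[OF loopN] by simp_all
  ultimately show ?R
    using NQ by (intro conjI ballI impI)
next
  assume R: ?R
  then have NQ: "\<And>n. n \<in> N \<Longrightarrow> n \<in> carrier Q" and one: "\<one> \<in> N"
    and mult: "\<And>x y. \<lbrakk>x \<in> N; y \<in> N\<rbrakk> \<Longrightarrow> x \<otimes> y \<in> N"
    and ldiv: "\<And>x a. \<lbrakk>x \<in> carrier Q; a \<in> N; a \<otimes> x \<in> N\<rbrakk> \<Longrightarrow> x \<in> N"
    and rdiv: "\<And>y a. \<lbrakk>y \<in> carrier Q; a \<in> N; y \<otimes> a \<in> N\<rbrakk> \<Longrightarrow> y \<in> N"
    by blast+
  have "\<exists>!x. x \<in> N \<and> a \<otimes> x = b" if ab: "a \<in> N" "b \<in> N" for a b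
  proof -
    obtain x where x: "x \<in> carrier Q" "a \<otimes> x = b"
      using left_div[OF NQ[OF ab(1)] NQ[OF ab(2)]] .
    then have "x \<in> N"
      using ldiv[of x a] ab by simp
    moreover have "x' = x" if "x' \<in> N" "a \<otimes> x' = b" for x'
      using that left_cancel[of a x' x] x NQ ab(1) by simp
    ultimately show ?thesis
      using x(2) by blast
  qed
  moreover have "\<exists>!y. y \<in> N \<and> y \<otimes> a = b" if ab: "a \<in> N" "b \<in> N" for a b
  proof -
    obtain y where y: "y \<in> carrier Q" "y \<otimes> a = b"
      using right_div[OF NQ[OF ab(1)] NQ[OF ab(2)]] .
    then have "y \<in> N"
      using rdiv[of y a] ab by simp
    moreover have "y' = y" if "y' \<in> N" "y' \<otimes> a = b" for y'
      using that right_cancel[of y' a y] y NQ ab(1) by simp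
    ultimately show ?thesis
      using y(2) by blast
  qed
  ultimately have "loop (Q\<lparr>carrier := N\<rparr>)"
    by (intro loop.intro) (simp_all add: NQ one mult)
  then show "subloop N Q"
    using R by (simp add: subloop_def)
qed

lemma
  assumes "subloop N Q"
  shows subloop_closed: "n \<in> N \<Longrightarrow> n \<in> carrier Q"
    and subloop_one: "\<one> \<in> N"
    and subloop_mult: "\<lbrakk>x \<in> N; y \<in> N\<rbrakk> \<Longrightarrow> x \<otimes> y \<in> N"
    and subloop_left_div: "\<lbrakk>x \<in> carrier Q; a \<in> N; a \<otimes> x \<in> N\<rbrakk> \<Longrightarrow> x \<in> N"
    and subloop_right_div: "\<lbrakk>y \<in> carrier Q; a \<in> N; y \<otimes> a \<in> N\<rbrakk> \<Longrightarrow> y \<in> N"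
  using assms unfolding subloop_iff by blast+

lemma subloop_carrier: "subloop (carrier Q) Q"
  by (simp add: subloop_iff)

text \<open>The hull is an intersection of subloops, and closure conditions survive intersections.
  The whole loop contains \<open>T\<close>, so the intersected family is nonempty and the result
  stays inside \<open>carrier Q\<close>.\<close>

lemma subloop_generated:
  assumes "T \<subseteq> carrier Q"
  shows "subloop (generated_subloop Q T) Q"
proof -
  have Inter: "subloop (\<Inter>\<H>) Q"
    if ne: "\<H> \<noteq> {}" and sub: "\<And>H. H \<in> \<H> \<Longrightarrow> subloop H Q" for \<H>
  proof -
    have "\<Inter>\<H> \<subseteq> carrier Q"
      using ne sub subloop_closed by blast
    moreover have "\<one> \<in> \<Inter>\<H>"
      using sub subloop_one by blast
    moreover have "x \<otimes> y \<in> \<Inter>\<H>" if "x \<in> \<Inter>\<H>" "y \<in> \<Inter>\<H>" for x y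
      using that subloop_mult[OF sub] by blast
    moreover have "x \<in> \<Inter>\<H>" if "x \<in> carrier Q" "a \<in> \<Inter>\<H>" "a \<otimes> x \<in> \<Inter>\<H>" for x a
      using that subloop_left_div[OF sub, of _ x a] by blast
    moreover have "y \<in> \<Inter>\<H>" if "y \<in> carrier Q" "a \<in> \<Inter>\<H>" "y \<otimes> a \<in> \<Inter>\<H>" for y a
      using that subloop_right_div[OF sub, of _ y a] by blast
    ultimately show ?thesis
      unfolding subloop_iff by (intro conjI ballI impI)
  qed
  show ?thesis
    unfolding generated_subloop_def hull_def
  proof (rule Inter)
    show "{H. subloop H Q \<and> T \<subseteq> H} \<noteq> {}"
      using assms subloop_carrier by blast
  qed simp
qed

section \<open>The associators\<close>

text \<open>Right division by \<open>y z\<close> and then by \<open>x\<close> solves the defining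
  equation, and cancellation makes the solution unique, so the \<open>THE\<close> in the definition
  denotes it.\<close>

lemma assoc_a:
  assumes "x \<in> carrier Q" "y \<in> carrier Q" "z \<in> carrier Q"
  shows "assoc_a Q x y z \<in> carrier Q"
    and "(x \<otimes> y) \<otimes> z = (assoc_a Q x y z \<otimes> x) \<otimes> (y \<otimes> z)"
proof -
  obtain c where c: "c \<in> carrier Q" "c \<otimes> (y \<otimes> z) = (x \<otimes> y) \<otimes> z"
    using right_div[of "y \<otimes> z" "(x \<otimes> y) \<otimes> z"] assms by blast
  obtain a where a: "a \<in> carrier Q" "a \<otimes> x = c"
    using right_div[of x c] assms c by blast
  have "\<exists>!a. a \<in> carrier Q \<and> (x \<otimes> y) \<otimes> z = (a \<otimes> x) \<otimes> (y \<otimes> z)"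
    using a c assms right_cancel by (metis m_closed)
  then have "assoc_a Q x y z \<in> carrier Q \<and>
      (x \<otimes> y) \<otimes> z = (assoc_a Q x y z \<otimes> x) \<otimes> (y \<otimes> z)"
    unfolding assoc_a_def by (rule theI')
  then show "assoc_a Q x y z \<in> carrier Q"
      and "(x \<otimes> y) \<otimes> z = (assoc_a Q x y z \<otimes> x) \<otimes> (y \<otimes> z)"
    by auto
qed

text \<open>Mirror image of the previous argument, with left division by \<open>z y\<close> and then
  by \<open>x\<close>.\<close>

lemma assoc_b:
  assumes "x \<in> carrier Q" "y \<in> carrier Q" "z \<in> carrier Q"
  shows "assoc_b Q x y z \<in> carrier Q"
    and "z \<otimes> (y \<otimes> x) = (z \<otimes> y) \<otimes> (x \<otimes> assoc_b Q x y z)"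
proof -
  obtain c where c: "c \<in> carrier Q" "(z \<otimes> y) \<otimes> c = z \<otimes> (y \<otimes> x)"
    using left_div[of "z \<otimes> y" "z \<otimes> (y \<otimes> x)"] assms by blast
  obtain b where b: "b \<in> carrier Q" "x \<otimes> b = c"
    using left_div[of x c] assms c by blast
  have "\<exists>!b. b \<in> carrier Q \<and> z \<otimes> (y \<otimes> x) = (z \<otimes> y) \<otimes> (x \<otimes> b)"
    using b c assms left_cancel by (metis m_closed)
  then have "assoc_b Q x y z \<in> carrier Q \<and>
      z \<otimes> (y \<otimes> x) = (z \<otimes> y) \<otimes> (x \<otimes> assoc_b Q x y z)"
    unfolding assoc_b_def by (rule theI')
  then show "assoc_b Q x y z \<in> carrier Q"
      and "z \<otimes> (y \<otimes> x) = (z \<otimes> y) \<otimes> (x \<otimes> assoc_b Q x y z)"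
    by auto
qed

text \<open>Only the elements \<open>a(x,y,z)\<close> are collected; the \<open>b(x,y,z)\<close>
  come back at the end through the group quotient.\<close>

definition associators :: "'a set"
  where "associators = {assoc_a Q x y z | x y z. x \<in> carrier Q \<and> y \<in> carrier Q \<and> z \<in> carrier Q}"

lemma assoc_a_mem:
  "\<lbrakk>x \<in> carrier Q; y \<in> carrier Q; z \<in> carrier Q\<rbrakk> \<Longrightarrow> assoc_a Q x y z \<in> associators"
  unfolding associators_def by blast

lemma associators_subset: "associators \<subseteq> carrier Q"
  unfolding associators_def using assoc_a by blast

section \<open>Right cosets and the action by right multiplication\<close>

lemma mem_rcoset:
  assumes "subloop N Q" "x \<in> carrier Q"
  shows "x \<in> N #> x"
  using subloop_one[OF assms(1)] l_one[OF assms(2)] by (auto simp: r_coset_def intro!: bexI[of _ \<one>])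

text \<open>Right translation by an element of \<open>N\<close> permutes \<open>N\<close>, as right
  division stays inside. This makes \<open>N\<close> the stabilizer of the coset
  \<open>N\<close>.\<close>

lemma rcoset_eq_self_iff:
  assumes "subloop N Q" "x \<in> carrier Q"
  shows "N #> x = N \<longleftrightarrow> x \<in> N"
proof
  assume "N #> x = N"
  then show "x \<in> N"
    using mem_rcoset[OF assms] by simp
next
  assume x: "x \<in> N"
  show "N #> x = N"
  proof
    show "N #> x \<subseteq> N"
      using subloop_mult[OF assms(1)] x by (auto simp: r_coset_def)
    show "N \<subseteq> N #> x"
    proof
      fix n assume n: "n \<in> N"
      obtain m where m: "m \<in> carrier Q" "m \<otimes> x = n"
        using right_div[OF assms(2) subloop_closed[OF assms(1) n]] .
      then have "m \<in> N"
        using subloop_right_div[OF assms(1), of m x] n x by simp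
      then show "n \<in> N #> x"
        using m by (auto simp: r_coset_def)
    qed
  qed
qed

text \<open>Rebracketing \<open>(n x) y\<close> costs only the factor \<open>a(n,x,y)\<close>, which
  lies in \<open>N\<close> and merges with \<open>n\<close>. This lets right multiplication act on
  right cosets, and it is also the third condition of normality.\<close>

lemma rcoset_rcoset:
  assumes sub: "subloop N Q" and A: "associators \<subseteq> N"
    and x: "x \<in> carrier Q" and y: "y \<in> carrier Q"
  shows "(N #> x) #> y = N #> (x \<otimes> y)"
proof
  have NQ: "\<And>n. n \<in> N \<Longrightarrow> n \<in> carrier Q"
    using subloop_closed[OF sub] .
  show "(N #> x) #> y \<subseteq> N #> (x \<otimes> y)"
  proof
    fix u assume "u \<in> (N #> x) #> y"
    then obtain n where n: "n \<in> N" "u = (n \<otimes> x) \<otimes> y"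
      by (auto simp: r_coset_def)
    have "u = (assoc_a Q n x y \<otimes> n) \<otimes> (x \<otimes> y)"
      using assoc_a(2)[of n x y] n NQ x y by simp
    moreover have "assoc_a Q n x y \<otimes> n \<in> N"
      using assoc_a_mem[of n x y] A n NQ x y subloop_mult[OF sub] by blast
    ultimately show "u \<in> N #> (x \<otimes> y)"
      by (auto simp: r_coset_def)
  qed
  show "N #> (x \<otimes> y) \<subseteq> (N #> x) #> y"
  proof
    fix u assume "u \<in> N #> (x \<otimes> y)"
    then obtain n where n: "n \<in> N" "u = n \<otimes> (x \<otimes> y)"
      by (auto simp: r_coset_def)
    then have nQ: "n \<in> carrier Q" and uQ: "u \<in> carrier Q"
      using NQ x y by auto
    \<comment> \<open>Two right divisions write \<open>u\<close> as \<open>(t x) y\<close>.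
      Comparison with \<open>n (x y)\<close> gives \<open>a(t,x,y) t = n\<close>, and left division
      puts \<open>t\<close> in \<open>N\<close>.\<close>
    obtain v where v: "v \<in> carrier Q" "v \<otimes> y = u"
      using right_div[OF y uQ] .
    obtain t where t: "t \<in> carrier Q" "t \<otimes> x = v"
      using right_div[OF x v(1)] .
    have a: "assoc_a Q t x y \<in> N" "assoc_a Q t x y \<in> carrier Q"
      using assoc_a_mem[of t x y] assoc_a(1)[of t x y] A t x y by auto
    have "(assoc_a Q t x y \<otimes> t) \<otimes> (x \<otimes> y) = n \<otimes> (x \<otimes> y)"
      using assoc_a(2)[of t x y] t v n x y by simp
    then have "assoc_a Q t x y \<otimes> t = n"
      using right_cancel[of "assoc_a Q t x y \<otimes> t" "x \<otimes> y" n] a t nQ x y by simp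
    then have "t \<in> N"
      using subloop_left_div[OF sub, of t "assoc_a Q t x y"] a t n by simp
    then show "u \<in> (N #> x) #> y"
      using t v by (auto simp: r_coset_def)
  qed
qed

lemma rcoset_repr_eq:
  assumes "subloop N Q" "associators \<subseteq> N" "x \<in> carrier Q" "n \<in> N"
  shows "N #> (n \<otimes> x) = N #> x"
proof -
  have "n \<in> carrier Q"
    using subloop_closed assms by blast
  then show ?thesis
    using rcoset_rcoset[of N n x] rcoset_eq_self_iff[of N n] assms by simp
qed

text \<open>Translation by \<open>z\<close> sends \<open>N #> x\<close> to
  \<open>(N #> x) #> z\<close>, which depends on the coset alone.\<close>

lemma rcoset_mult_cong:
  assumes "subloop N Q" "associators \<subseteq> N" "x \<in> carrier Q" "y \<in> carrier Q" "z \<in> carrier Q"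
    and "N #> x = N #> y"
  shows "N #> (x \<otimes> z) = N #> (y \<otimes> z)"
  using assms rcoset_rcoset by metis

text \<open>Injectivity of translation by \<open>z\<close> on cosets: \<open>x z\<close> lies in
  \<open>(N #> y) #> z\<close>, and \<open>z\<close> cancels in the loop.\<close>

lemma rcoset_mult_cancel:
  assumes "subloop N Q" "associators \<subseteq> N" "x \<in> carrier Q" "y \<in> carrier Q" "z \<in> carrier Q"
    and "N #> (x \<otimes> z) = N #> (y \<otimes> z)"
  shows "N #> x = N #> y"
proof -
  have "x \<otimes> z \<in> (N #> y) #> z"
    using assms rcoset_rcoset mem_rcoset[of N "x \<otimes> z"] by simp
  then obtain n where n: "n \<in> N" "x \<otimes> z = (n \<otimes> y) \<otimes> z"
    by (auto simp: r_coset_def)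
  then have "n \<in> carrier Q"
    using subloop_closed assms(1) by blast
  then have "x = n \<otimes> y"
    using n right_cancel[of x z "n \<otimes> y"] assms by simp
  then show ?thesis
    using rcoset_repr_eq assms n by simp
qed

text \<open>The factor \<open>a(x,y,z)\<close> lies in \<open>N\<close> and is absorbed by the
  coset. Hence \<open>x y\<close> acts as \<open>x\<close> followed by \<open>y\<close>... applied
  here at the coset of the first factor.\<close>

lemma rcoset_assoc:
  assumes "subloop N Q" "associators \<subseteq> N" "x \<in> carrier Q" "y \<in> carrier Q" "z \<in> carrier Q"
  shows "N #> ((x \<otimes> y) \<otimes> z) = N #> (x \<otimes> (y \<otimes> z))"
proof -
  let ?a = "assoc_a Q x y z"
  have "?a \<in> N" "?a \<in> carrier Q"
    using assoc_a_mem[of x y z] assoc_a(1)[of x y z] assms by auto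
  then show ?thesis
    using assoc_a(2)[of x y z] rcoset_mult_cong[of N "?a \<otimes> x" x "y \<otimes> z"] rcoset_repr_eq assms
    by simp
qed

section \<open>The kernel of the action on right cosets\<close>

definition rcoset_kernel :: "'a set \<Rightarrow> 'a set"
  where "rcoset_kernel N = {k \<in> carrier Q. \<forall>w\<in>carrier Q. N #> (w \<otimes> k) = N #> w}"

text \<open>An element fixing all cosets fixes \<open>N\<close> itself (take \<open>w\<close> to be
  the identity), and the stabilizer of \<open>N\<close> is \<open>N\<close>.\<close>

lemma rcoset_kernel_subset:
  assumes "subloop N Q"
  shows "rcoset_kernel N \<subseteq> N"
proof
  fix k assume "k \<in> rcoset_kernel N"
  then have k: "k \<in> carrier Q" "N #> (\<one> \<otimes> k) = N #> \<one>"
    unfolding rcoset_kernel_def by blast+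
  have "N #> \<one> = N"
    using subloop_one rcoset_eq_self_iff assms by blast
  then show "k \<in> N"
    using k rcoset_eq_self_iff[OF assms, of k] by simp
qed

lemma rcoset_kernelD:
  "\<lbrakk>k \<in> rcoset_kernel N; w \<in> carrier Q\<rbrakk> \<Longrightarrow> N #> (w \<otimes> k) = N #> w"
  unfolding rcoset_kernel_def by blast

lemma rcoset_kernel_closed: "k \<in> rcoset_kernel N \<Longrightarrow> k \<in> carrier Q"
  unfolding rcoset_kernel_def by blast

text \<open>Every element of \<open>Q\<close> is some \<open>w x\<close>, so in the action on right cosets it is enough to
  see that \<open>t\<close> fixes the cosets of these products.\<close>

lemma rcoset_kernelI:
  assumes "t \<in> carrier Q" "x \<in> carrier Q"
    and "\<And>w. w \<in> carrier Q \<Longrightarrow> N #> ((w \<otimes> x) \<otimes> t) = N #> (w \<otimes> x)"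
  shows "t \<in> rcoset_kernel N"
proof -
  have "N #> (v \<otimes> t) = N #> v" if "v \<in> carrier Q" for v
    using right_div[OF assms(2) that] assms(3) by metis
  then show ?thesis
    unfolding rcoset_kernel_def using assms(1) by blast
qed

text \<open>The product \<open>k l\<close> acts as \<open>k\<close> followed by \<open>l\<close>. If
  one factor acts trivially, the product acts as the other, which settles products and both
  divisions.\<close>

lemma subloop_rcoset_kernel:
  assumes N: "subloop N Q" "associators \<subseteq> N"
  shows "subloop (rcoset_kernel N) Q"
proof -
  have mult: "N #> (w \<otimes> (k \<otimes> l)) = N #> (w \<otimes> l)"
    if "k \<in> rcoset_kernel N" "l \<in> carrier Q" "w \<in> carrier Q" for k l w
    using that rcoset_assoc[OF N, of w k l] rcoset_mult_cong[OF N, of "w \<otimes> k" w l]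
      rcoset_kernelD[of k N w] rcoset_kernel_closed[of k N] by simp
  have mult': "N #> (w \<otimes> (k \<otimes> l)) = N #> (w \<otimes> k)"
    if "l \<in> rcoset_kernel N" "k \<in> carrier Q" "w \<in> carrier Q" for k l w
    using that rcoset_assoc[OF N, of w k l] rcoset_kernelD[of l N "w \<otimes> k"]
      rcoset_kernel_closed[of l N] by simp
  show ?thesis
    unfolding subloop_iff
  proof (intro conjI ballI impI)
    show "rcoset_kernel N \<subseteq> carrier Q" "\<one> \<in> rcoset_kernel N"
      unfolding rcoset_kernel_def by auto
    show "x \<otimes> y \<in> rcoset_kernel N" if "x \<in> rcoset_kernel N" "y \<in> rcoset_kernel N" for x y
      using that mult[of x y] unfolding rcoset_kernel_def by auto
    show "x \<in> rcoset_kernel N"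
      if "x \<in> carrier Q" "a \<in> rcoset_kernel N" "a \<otimes> x \<in> rcoset_kernel N" for x a
      using that mult[of a x] unfolding rcoset_kernel_def by auto
    show "y \<in> rcoset_kernel N"
      if "y \<in> carrier Q" "a \<in> rcoset_kernel N" "y \<otimes> a \<in> rcoset_kernel N" for y a
      using that mult'[of a y] unfolding rcoset_kernel_def by auto
  qed
qed

text \<open>In the defining equation of \<open>a\<close>, one side acts as \<open>x\<close>,
  \<open>y\<close>, \<open>z\<close> in turn and the other as \<open>a\<close>, \<open>x\<close>,
  \<open>y\<close>, \<open>z\<close>. Cancelling these permutations leaves \<open>a\<close> acting
  trivially.\<close>

lemma associators_subset_rcoset_kernel:
  assumes N: "subloop N Q" "associators \<subseteq> N"
  shows "associators \<subseteq> rcoset_kernel N"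
proof
  fix a assume "a \<in> associators"
  then obtain x y z where xyz: "x \<in> carrier Q" "y \<in> carrier Q" "z \<in> carrier Q"
    and a_def: "a = assoc_a Q x y z"
    unfolding associators_def by blast
  have a: "a \<in> carrier Q" and eq: "(x \<otimes> y) \<otimes> z = (a \<otimes> x) \<otimes> (y \<otimes> z)"
    using assoc_a[OF xyz] a_def by auto
  have "N #> (w \<otimes> a) = N #> w" if w: "w \<in> carrier Q" for w
  proof -
    have "N #> (w \<otimes> ((x \<otimes> y) \<otimes> z)) = N #> ((w \<otimes> (x \<otimes> y)) \<otimes> z)"
      using rcoset_assoc[OF N] w xyz by simp
    also have "\<dots> = N #> (((w \<otimes> x) \<otimes> y) \<otimes> z)"
      using rcoset_mult_cong[OF N _ _ _ rcoset_assoc[OF N]] w xyz by simp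
    also have "\<dots> = N #> ((w \<otimes> x) \<otimes> (y \<otimes> z))"
      using rcoset_assoc[OF N] w xyz by simp
    finally have 1: "N #> (w \<otimes> ((x \<otimes> y) \<otimes> z)) = N #> ((w \<otimes> x) \<otimes> (y \<otimes> z))" .
    have "N #> (w \<otimes> ((a \<otimes> x) \<otimes> (y \<otimes> z))) = N #> ((w \<otimes> (a \<otimes> x)) \<otimes> (y \<otimes> z))"
      using rcoset_assoc[OF N] w a xyz by simp
    also have "\<dots> = N #> (((w \<otimes> a) \<otimes> x) \<otimes> (y \<otimes> z))"
      using rcoset_mult_cong[OF N _ _ _ rcoset_assoc[OF N]] w a xyz by simp
    finally have "N #> (((w \<otimes> a) \<otimes> x) \<otimes> (y \<otimes> z)) = N #> ((w \<otimes> x) \<otimes> (y \<otimes> z))"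
      using 1 eq by simp
    then have "N #> ((w \<otimes> a) \<otimes> x) = N #> (w \<otimes> x)"
      using rcoset_mult_cancel[OF N, of "(w \<otimes> a) \<otimes> x" "w \<otimes> x" "y \<otimes> z"] w a xyz by simp
    then show ?thesis
      using rcoset_mult_cancel[OF N, of "w \<otimes> a" w x] w a xyz by simp
  qed
  then show "a \<in> rcoset_kernel N"
    unfolding rcoset_kernel_def using a by blast
qed

text \<open>The kernel lies in the stabilizer \<open>S\<close>; conversely it is a subloop
  containing the generators of \<open>S\<close>, so minimality of the hull applies.\<close>

lemma rcoset_kernel_generated:
  defines "S \<equiv> generated_subloop Q associators"
  shows "rcoset_kernel S = S"
proof
  have S: "subloop S Q" "associators \<subseteq> S"
    unfolding S_def using subloop_generated[OF associators_subset]
    by (auto simp: generated_subloop_def hull_subset)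
  show "rcoset_kernel S \<subseteq> S"
    using rcoset_kernel_subset[OF S(1)] .
  have "(\<lambda>H. subloop H Q) hull associators \<subseteq> rcoset_kernel S"
    using associators_subset_rcoset_kernel[OF S] subloop_rcoset_kernel[OF S]
    by (rule hull_minimal)
  then show "S \<subseteq> rcoset_kernel S"
    by (simp add: S_def generated_subloop_def)
qed

section \<open>Normality and the quotient group\<close>

text \<open>The hypothesis \<open>ker\<close> turns membership in \<open>N\<close> into acting
  trivially on right cosets. To show that an element lies in a left coset, divide and check that the
  quotient \<open>t\<close> acts trivially.\<close>

lemma normal_subloopI:
  assumes N: "subloop N Q" "associators \<subseteq> N" and ker: "rcoset_kernel N = N"
  shows "normal_subloop N Q"
proof -
  have NQ: "\<And>n. n \<in> N \<Longrightarrow> n \<in> carrier Q"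
    using subloop_closed[OF N(1)] .
  have fixed: "N #> (w \<otimes> n) = N #> w" if "w \<in> carrier Q" "n \<in> N" for w n
    using rcoset_kernelD[of n N w] that ker by simp
  have comm: "x <# N = N #> x" if x: "x \<in> carrier Q" for x
  proof
    show "x <# N \<subseteq> N #> x"
    proof
      fix u assume "u \<in> x <# N"
      then obtain n where n: "n \<in> N" "u = x \<otimes> n"
        by (auto simp: l_coset_def)
      then show "u \<in> N #> x"
        using mem_rcoset[OF N(1), of u] fixed[of x n] x NQ by auto
    qed
    show "N #> x \<subseteq> x <# N"
    proof
      fix u assume "u \<in> N #> x"
      then obtain n where n: "n \<in> N" "u = n \<otimes> x"
        by (auto simp: r_coset_def)
      then have u: "u \<in> carrier Q"
        using x NQ by simp
      obtain t where t: "t \<in> carrier Q" "x \<otimes> t = u"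
        using left_div[OF x u] .
      \<comment> \<open>Since \<open>x t = n x\<close> and \<open>n\<close> acts trivially,
        \<open>x\<close> followed by \<open>t\<close> acts as \<open>x\<close> alone.\<close>
      have "N #> ((w \<otimes> x) \<otimes> t) = N #> (w \<otimes> x)" if w: "w \<in> carrier Q" for w
      proof -
        have "N #> ((w \<otimes> x) \<otimes> t) = N #> (w \<otimes> (n \<otimes> x))"
          using rcoset_assoc[OF N, of w x t] t n w x by simp
        also have "\<dots> = N #> ((w \<otimes> n) \<otimes> x)"
          using rcoset_assoc[OF N, of w n x] n w x NQ by simp
        also have "\<dots> = N #> (w \<otimes> x)"
          using rcoset_mult_cong[OF N, of "w \<otimes> n" w x] fixed n w x NQ by simp
        finally show ?thesis .
      qed
      then have "t \<in> N"
        using rcoset_kernelI[OF t(1) x] ker by blast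
      then show "u \<in> x <# N"
        using t by (auto simp: l_coset_def)
    qed
  qed
  have lcoset: "x <# (y <# N) = (x \<otimes> y) <# N" if xy: "x \<in> carrier Q" "y \<in> carrier Q" for x y
  proof
    have eq: "N #> (x \<otimes> (y \<otimes> t)) = N #> ((x \<otimes> y) \<otimes> t)" if "t \<in> carrier Q" for t
      using rcoset_assoc[OF N] xy that by simp
    show "x <# (y <# N) \<subseteq> (x \<otimes> y) <# N"
    proof
      fix u assume "u \<in> x <# (y <# N)"
      then obtain n where n: "n \<in> N" "u = x \<otimes> (y \<otimes> n)"
        by (auto simp: l_coset_def)
      \<comment> \<open>Rebracketing preserves right cosets and \<open>n\<close> acts trivially, so
        \<open>u\<close> lies in \<open>N (x y)\<close>, which is \<open>(x y) N\<close> by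
        \<open>comm\<close>.\<close>
      then show "u \<in> (x \<otimes> y) <# N"
        using mem_rcoset[OF N(1), of u] comm[of "x \<otimes> y"] eq[of n] fixed[of "x \<otimes> y" n] xy NQ
        by simp
    qed
    show "(x \<otimes> y) <# N \<subseteq> x <# (y <# N)"
    proof
      fix u assume "u \<in> (x \<otimes> y) <# N"
      then obtain n where n: "n \<in> N" "u = (x \<otimes> y) \<otimes> n"
        by (auto simp: l_coset_def)
      then have u: "u \<in> carrier Q"
        using xy NQ by simp
      obtain v where v: "v \<in> carrier Q" "x \<otimes> v = u"
        using left_div[OF xy(1) u] .
      obtain t where t: "t \<in> carrier Q" "y \<otimes> t = v"
        using left_div[OF xy(2) v(1)] .
      \<comment> \<open>Here \<open>x (y t) = (x y) n\<close>, so after \<open>x y\<close> the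
        element \<open>t\<close> acts as \<open>n\<close> does, that is trivially.\<close>
      have "N #> ((w \<otimes> (x \<otimes> y)) \<otimes> t) = N #> (w \<otimes> (x \<otimes> y))" if w: "w \<in> carrier Q" for w
      proof -
        have "N #> ((w \<otimes> (x \<otimes> y)) \<otimes> t) = N #> (((w \<otimes> x) \<otimes> y) \<otimes> t)"
          using rcoset_mult_cong[OF N _ _ _ rcoset_assoc[OF N]] w xy t by simp
        also have "\<dots> = N #> ((w \<otimes> x) \<otimes> v)"
          using rcoset_assoc[OF N, of "w \<otimes> x" y t] t w xy by simp
        also have "\<dots> = N #> (w \<otimes> ((x \<otimes> y) \<otimes> n))"
          using rcoset_assoc[OF N, of w x v] v n w xy by simp
        also have "\<dots> = N #> ((w \<otimes> (x \<otimes> y)) \<otimes> n)"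
          using rcoset_assoc[OF N, of w "x \<otimes> y" n] n w xy NQ by simp
        also have "\<dots> = N #> (w \<otimes> (x \<otimes> y))"
          using fixed n w xy by simp
        finally show ?thesis .
      qed
      then have "t \<in> N"
        using rcoset_kernelI[OF t(1), of "x \<otimes> y"] xy ker by blast
      then show "u \<in> x <# (y <# N)"
        using t v by (auto simp: l_coset_def)
    qed
  qed
  show ?thesis
    unfolding normal_subloop_def using N comm lcoset rcoset_rcoset[OF N] by simp
qed

lemma group_Mod:
  assumes normal: "normal_subloop N Q" and A: "associators \<subseteq> N"
  shows "group (Q Mod N)"
proof -
  have N: "subloop N Q"
    using normal unfolding normal_subloop_def by blast
  then have one: "N #> \<one> = N"
    using rcoset_eq_self_iff[OF N, of \<one>] subloop_one[OF N] by simp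
  have coset: "N #> x \<in> rcosets N" if "x \<in> carrier Q" for x
    using that by (auto simp: RCOSETS_def)
  have one_mem: "N \<in> rcosets N"
    using coset[of \<one>] one by simp
  show ?thesis
  proof (rule groupI, simp_all add: FactGroup_def one_mem)
    fix X assume "X \<in> rcosets N"
    then obtain x where x: "x \<in> carrier Q" "X = N #> x"
      by (auto simp: RCOSETS_def)
    show "N <#> X = X"
      using rcoset_mult[OF normal, of \<one> x] one x by simp
    \<comment> \<open>\<open>groupI\<close> asks only for a left inverse, and right division of the
      identity by \<open>x\<close> supplies a representative.\<close>
    obtain y where "y \<in> carrier Q" "y \<otimes> x = \<one>"
      using right_div[OF x(1) one_closed] .
    then show "\<exists>Y\<in>rcosets N. Y <#> X = N"
      using rcoset_mult[OF normal, of y x] one x coset by metis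
    fix Y assume "Y \<in> rcosets N"
    then obtain y where y: "y \<in> carrier Q" "Y = N #> y"
      by (auto simp: RCOSETS_def)
    show "X <#> Y \<in> rcosets N"
      using rcoset_mult[OF normal] coset x y by simp
    fix Z assume "Z \<in> rcosets N"
    then obtain z where z: "z \<in> carrier Q" "Z = N #> z"
      by (auto simp: RCOSETS_def)
    show "X <#> Y <#> Z = X <#> (Y <#> Z)"
      using rcoset_mult[OF normal] rcoset_assoc[OF N A] x y z by simp
  qed
qed

text \<open>Passing to cosets is a homomorphism. In the group quotient both bracketings agree, so
  the image of each defining equation forces the coset of the associator to be trivial.\<close>

lemma assoc_mem_normal_subloop:
  assumes normal: "normal_subloop N Q" and grp: "group (Q Mod N)"
    and xyz: "x \<in> carrier Q" "y \<in> carrier Q" "z \<in> carrier Q"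
  shows "assoc_a Q x y z \<in> N" and "assoc_b Q x y z \<in> N"
proof -
  interpret G: group "Q Mod N" by (rule grp)
  have N: "subloop N Q"
    using normal unfolding normal_subloop_def by blast
  let ?a = "assoc_a Q x y z" and ?b = "assoc_b Q x y z"
  note a = assoc_a[OF xyz] and b = assoc_b[OF xyz]
  have hom: "N #> (u \<otimes> v) = (N #> u) \<otimes>\<^bsub>Q Mod N\<^esub> (N #> v)"
    if "u \<in> carrier Q" "v \<in> carrier Q" for u v
    using rcoset_mult[OF normal that] by (simp add: FactGroup_def)
  have mem: "N #> u \<in> carrier (Q Mod N)" if "u \<in> carrier Q" for u
    using that by (auto simp: FactGroup_def RCOSETS_def)
  have one: "\<one>\<^bsub>Q Mod N\<^esub> = N"
    by (simp add: FactGroup_def)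
  have "((N #> x) \<otimes>\<^bsub>Q Mod N\<^esub> (N #> y)) \<otimes>\<^bsub>Q Mod N\<^esub> (N #> z) =
      ((N #> ?a) \<otimes>\<^bsub>Q Mod N\<^esub> (N #> x)) \<otimes>\<^bsub>Q Mod N\<^esub> ((N #> y) \<otimes>\<^bsub>Q Mod N\<^esub> (N #> z))"
    using arg_cong[OF a(2), of "\<lambda>u. N #> u"] a(1) xyz by (simp add: hom)
  \<comment> \<open>The deleted rules would unfold the quotient operations; kept folded, they match
    the cancellation rules of \<open>G\<close>.\<close>
  then have "N #> ?a = \<one>\<^bsub>Q Mod N\<^esub>"
    using mem[OF a(1)] mem[OF xyz(1)] mem[OF xyz(2)] mem[OF xyz(3)]
    by (simp add: G.m_assoc[symmetric] del: mult_FactGroup one_FactGroup)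
  then show "?a \<in> N"
    using rcoset_eq_self_iff[OF N a(1)] one by simp
  have "(N #> z) \<otimes>\<^bsub>Q Mod N\<^esub> ((N #> y) \<otimes>\<^bsub>Q Mod N\<^esub> (N #> x)) =
      ((N #> z) \<otimes>\<^bsub>Q Mod N\<^esub> (N #> y)) \<otimes>\<^bsub>Q Mod N\<^esub> ((N #> x) \<otimes>\<^bsub>Q Mod N\<^esub> (N #> ?b))"
    using arg_cong[OF b(2), of "\<lambda>u. N #> u"] b(1) xyz by (simp add: hom)
  then have "N #> ?b = \<one>\<^bsub>Q Mod N\<^esub>"
    using mem[OF b(1)] mem[OF xyz(1)] mem[OF xyz(2)] mem[OF xyz(3)]
    by (simp add: G.m_assoc del: mult_FactGroup one_FactGroup)
  then show "?b \<in> N"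
    using rcoset_eq_self_iff[OF N b(1)] one by simp
qed

end

section \<open>Identification of the associator subloop\<close>

theorem theorem8p4:
  fixes Q :: "('a, 'b) monoid_scheme"
  assumes "loop Q"
  shows "associator_subloop Q =
    generated_subloop Q
      ({assoc_a Q x y z | x y z. x \<in> carrier Q \<and> y \<in> carrier Q \<and> z \<in> carrier Q} \<union>
       {assoc_b Q x y z | x y z. x \<in> carrier Q \<and> y \<in> carrier Q \<and> z \<in> carrier Q})"
    (is "_ = generated_subloop Q (?A \<union> ?B)")
proof -
  interpret loop Q by (rule assms)
  define S where "S = generated_subloop Q associators"
  have A: "?A = associators"
    by (simp add: associators_def)
  have S: "subloop S Q" "associators \<subseteq> S"
    unfolding S_def using subloop_generated[OF associators_subset]
    by (auto simp: generated_subloop_def hull_subset)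
  have normal: "normal_subloop S Q"
    using normal_subloopI[OF S] rcoset_kernel_generated unfolding S_def by blast
  have grp: "group (Q Mod S)"
    using group_Mod[OF normal S(2)] .
  have minimal: "S \<subseteq> N" if "normal_subloop N Q" "group (Q Mod N)" for N
  proof -
    have "associators \<subseteq> N"
      using assoc_mem_normal_subloop(1)[OF that] unfolding associators_def by blast
    moreover have "subloop N Q"
      using that unfolding normal_subloop_def by blast
    ultimately show ?thesis
      unfolding S_def generated_subloop_def by (rule hull_minimal)
  qed
  \<comment> \<open>\<open>LEAST\<close> refers to inclusion of sets, so its value is determined by
    exhibiting an actual minimum, here \<open>S\<close>.\<close>
  have "associator_subloop Q = S"
    unfolding associator_subloop_def using normal grp minimal by (intro Least_equality) auto
  also have "S = generated_subloop Q (?A \<union> ?B)"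
  proof
    show "S \<subseteq> generated_subloop Q (?A \<union> ?B)"
      unfolding S_def generated_subloop_def A by (rule hull_mono) blast
    \<comment> \<open>Normality of \<open>S\<close> with a group quotient brings in the elements
      \<open>b(x,y,z)\<close>, so adding them as generators does not enlarge
      \<open>S\<close>.\<close>
    have "?A \<union> ?B \<subseteq> S"
      using assoc_mem_normal_subloop[OF normal grp] by blast
    then show "generated_subloop Q (?A \<union> ?B) \<subseteq> S"
      unfolding generated_subloop_def using S(1) by (rule hull_minimal)
  qed
  finally show ?thesis .
qed

end
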